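(* Let $g:\overline{\mathbb{D}}\to\mathbb{C}$ be continuous with $\|g\|_{\infty}<\frac{8}{3\pi}$. Let $f:\overline{\mathbb{D}}\to\mathbb{C}$ be continuous on $\overline{\mathbb{D}}$ and twice continuously differentiable in $\mathbb{D}$, with $f(\mathbb{D})\subseteq\mathbb{D}$ and $\Delta f=g$ in $\mathbb{D}$. If $f(0)=0$ and, for some $\zeta\in\mathbb{T}$, $\lim_{r\rightarrow1^{-}}|f(r\zeta)|=1$, then $$\liminf_{r\rightarrow1^{-}}\frac{|f(\zeta)-f(r\zeta)|}{1-r}\geq\frac{2}{\pi}-\frac{3\|g\|_{\infty}}{4},$$ where $r\in[0,1)$. In particular, if $\|g\|_{\infty}=0$, the estimate is sharp, i.e. in that case the constant $\frac{2}{\pi}$ on the right-hand side cannot be replaced by any larger constant.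
   Context: $\mathbb{D}=\{z\in\mathbb{C}:|z|<1\}$, $\mathbb{T}=\partial\mathbb{D}$, $\Delta f=f_{xx}+f_{yy}$ for $z=x+iy$, and $\|g\|_{\infty}=\sup_{z\in\mathbb{D}}|g(z)|$. *)

theory Defs
  imports "HOL-Analysis.Analysis"
begin

text \<open>Directional derivative of \<open>f\<close> at \<open>z\<close> along a fixed vector; the plane is viewed as a real
  vector space, so the directions \<open>1\<close> and \<open>\<i>\<close> give the partial derivatives in \<open>x\<close> and \<open>y\<close>.\<close>

definition partial :: "complex \<Rightarrow> (complex \<Rightarrow> complex) \<Rightarrow> complex \<Rightarrow> complex" where
  "partial v f z = vector_derivative (\<lambda>t::real. f (z + of_real t * v)) (at 0)"

definition partials_exist_on :: "complex set \<Rightarrow> (complex \<Rightarrow> complex) \<Rightarrow> bool" where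
  "partials_exist_on S f \<longleftrightarrow>
     (\<forall>z\<in>S. \<forall>v\<in>{1, \<i>}. (\<lambda>t::real. f (z + of_real t * v)) differentiable (at 0))"

text \<open>For an open set \<open>S\<close> this is the usual class of \<open>k\<close> times continuously (real) differentiable
  functions: all partial derivatives up to order \<open>k\<close> exist and are continuous on \<open>S\<close>.\<close>

primrec C_k_on :: "nat \<Rightarrow> complex set \<Rightarrow> (complex \<Rightarrow> complex) \<Rightarrow> bool" where
  "C_k_on 0 S f \<longleftrightarrow> continuous_on S f"
| "C_k_on (Suc k) S f \<longleftrightarrow> continuous_on S f \<and> partials_exist_on S f \<and>
     C_k_on k S (partial 1 f) \<and> C_k_on k S (partial \<i> f)"

definition laplacian :: "(complex \<Rightarrow> complex) \<Rightarrow> complex \<Rightarrow> complex" where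
  "laplacian f z = partial 1 (partial 1 f) z + partial \<i> (partial \<i> f) z"

text \<open>A real supremum, hence meaningful only for functions bounded on the disc, such as those
  continuous on the closed disc.\<close>

definition disc_norm :: "(complex \<Rightarrow> complex) \<Rightarrow> real" where
  "disc_norm g = (SUP z\<in>ball 0 1. norm (g z))"

text \<open>Functions on the closed disc are represented by total functions whose values outside it are
  irrelevant.\<close>

definition poisson_self_map ::
    "(complex \<Rightarrow> complex) \<Rightarrow> (complex \<Rightarrow> complex) \<Rightarrow> complex \<Rightarrow> bool" where
  "poisson_self_map g f \<zeta> \<longleftrightarrow>
     continuous_on (cball 0 1) g \<and> disc_norm g < 8 / (3 * pi) \<and>
     continuous_on (cball 0 1) f \<and> C_k_on 2 (ball 0 1) f \<and>
     f ` ball 0 1 \<subseteq> ball 0 1 \<and>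
     (\<forall>z\<in>ball 0 1. laplacian f z = g z) \<and>
     f 0 = 0 \<and> \<zeta> \<in> sphere 0 1 \<and>
     ((\<lambda>r::real. norm (f (of_real r * \<zeta>))) \<longlongrightarrow> 1) (at 1 within {0..<1})"

text \<open>Extended real, since the difference quotients need not be bounded as \<open>r\<close> tends to \<open>1\<close>.\<close>

definition radial_liminf :: "(complex \<Rightarrow> complex) \<Rightarrow> complex \<Rightarrow> ereal" where
  "radial_liminf f \<zeta> =
     Liminf (at (1::real) within {0..<1})
       (\<lambda>r. ereal (norm (f \<zeta> - f (of_real r * \<zeta>)) / (1 - r)))"

end

theory Submission
  imports Defs "HOL-Complex_Analysis.Complex_Analysis"
begin

text \<open>Let \<open>u = Re (c f)\<close> for a unimodular \<open>c\<close>, so that \<open>\<bar>\<Delta>u\<bar> \<le> M\<close> for \<open>M = \<parallel>g\<parallel>\<close>, and let \<open>h\<close> be the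
  harmonic function with the boundary values of \<open>u\<close>. Adding \<open>M\<bar>z\<bar>\<^sup>2/4\<close> makes \<open>u - h\<close> and
  \<open>h - u\<close> subharmonic, so the maximum principle gives \<open>\<bar>u - h\<bar> \<le> M(1 - \<bar>z\<bar>\<^sup>2)/4\<close>; in
  particular \<open>\<bar>h 0\<bar> \<le> M/4\<close>. A Schwarz lemma for harmonic functions not vanishing at \<open>0\<close>,
  obtained from the Poisson formula, then yields
  \<open>\<bar>f z\<bar> \<le> 4/\<pi> arctan r + M/4 ((1 - r\<^sup>2)/(1 + r\<^sup>2) + (1 - r\<^sup>2))\<close> with \<open>r = \<bar>z\<bar>\<close>, and the estimate follows
  by letting \<open>r\<close> tend to \<open>1\<close>. Instead of solving the Dirichlet problem, the boundary values are
  approximated uniformly by real parts of polynomials, which serve as \<open>h\<close>.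

  Sharpness is witnessed by \<open>Re (Arctan (s z)) / arctan s\<close> as \<open>s\<close> tends to \<open>1\<close>; these functions
  are continuous approximations of the discontinuous extremal \<open>4/\<pi> Re (Arctan z)\<close>.\<close>

section \<open>Maximum principle for perturbed solutions of the Poisson equation\<close>

text \<open>If \<open>D\<close> were positive, \<open>\<phi>'\<close>, which vanishes at the
  maximum, would be positive just to the right of \<open>0\<close>, and the mean value theorem would
  make \<open>\<phi>\<close> exceed \<open>\<phi> 0\<close> there. The second derivative is used at
  the single point \<open>0\<close>, which matches the pointwise partial derivatives below.\<close>

lemma second_derivative_nonpos_at_local_max:
  fixes \<phi> :: "real \<Rightarrow> real"
  assumes d: "d > 0"
    and deriv1: "\<And>t. \<bar>t\<bar> < d \<Longrightarrow> (\<phi> has_real_derivative \<phi>' t) (at t)"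
    and deriv2: "(\<phi>' has_real_derivative D) (at 0)"
    and max: "\<And>t. \<bar>t\<bar> < d \<Longrightarrow> \<phi> t \<le> \<phi> 0"
  shows "D \<le> 0"
proof (rule ccontr)
  assume "\<not> D \<le> 0"
  then have "D > 0" by simp
  have "\<phi>' 0 = 0"
    using DERIV_local_max[OF deriv1[of 0] d] d max by simp
  from has_real_derivative_pos_inc_right[OF deriv2 \<open>D > 0\<close>] this
  obtain e where e: "e > 0" "\<And>h. 0 < h \<Longrightarrow> h < e \<Longrightarrow> \<phi>' h > 0"
    by auto
  define h where "h = min d e / 2"
  have h: "0 < h" "h < d" "h < e"
    using d e(1) by (auto simp: h_def)
  have "\<exists>z>0. z < h \<and> \<phi> h - \<phi> 0 = (h - 0) * \<phi>' z"
    by (rule MVT2[OF h(1)]) (use h deriv1 in auto)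
  then obtain z where "0 < z" "z < h" "\<phi> h - \<phi> 0 = h * \<phi>' z"
    by auto
  moreover from this have "h * \<phi>' z > 0"
    using e(2)[of z] h by simp
  ultimately show False
    using max[of h] h by simp
qed

text \<open>The maximum over the compact disc cannot be interior: along each of the two axis
  directions the second derivative there would be at most \<open>0\<close>, against
  \<open>pos\<close>. The functions \<open>k1\<close> and \<open>k2\<close> take the direction as an
  argument so that both axes are treated at once.\<close>

lemma strict_subharmonic_le_boundary:
  fixes k :: "complex \<Rightarrow> real" and k1 k2 :: "complex \<Rightarrow> complex \<Rightarrow> real"
  assumes cont: "continuous_on (cball 0 1) k"
    and deriv1: "\<And>z v. z \<in> ball 0 1 \<Longrightarrow> v \<in> {1, \<i>} \<Longrightarrow>
      ((\<lambda>t. k (z + of_real t * v)) has_real_derivative k1 v z) (at 0)"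
    and deriv2: "\<And>z v. z \<in> ball 0 1 \<Longrightarrow> v \<in> {1, \<i>} \<Longrightarrow>
      ((\<lambda>t. k1 v (z + of_real t * v)) has_real_derivative k2 v z) (at 0)"
    and pos: "\<And>z. z \<in> ball 0 1 \<Longrightarrow> k2 1 z + k2 \<i> z > 0"
    and bound: "\<And>z. z \<in> sphere 0 1 \<Longrightarrow> k z \<le> B"
    and z: "z \<in> cball 0 1"
  shows "k z \<le> B"
proof -
  obtain w where w: "w \<in> cball 0 1" "\<And>y. y \<in> cball 0 1 \<Longrightarrow> k y \<le> k w"
    using continuous_attains_sup[OF compact_cball _ cont] by auto
  have "w \<notin> ball 0 1"
  proof
    assume wb: "w \<in> ball 0 1"
    define d where "d = 1 - norm w"
    have d: "d > 0" using wb by (simp add: d_def)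
    have inball: "w + of_real t * v \<in> ball 0 1" if "\<bar>t\<bar> < d" "v \<in> {1, \<i>}" for t v
    proof -
      have "norm (of_real t * v) = \<bar>t\<bar>"
        using that(2) by (auto simp: norm_mult)
      then show ?thesis
        using norm_triangle_ineq[of w "of_real t * v"] that(1) by (simp add: d_def)
    qed
    have "k2 v w \<le> 0" if v: "v \<in> {1, \<i>}" for v
    proof (rule second_derivative_nonpos_at_local_max[OF d])
      \<comment> \<open>The hypothesis gives derivatives at parameter \<open>0\<close> only; moving
        the base point along the segment gives them at every \<open>t\<close>.\<close>
      show "((\<lambda>t. k (w + of_real t * v)) has_real_derivative k1 v (w + of_real t * v)) (at t)"
        if t: "\<bar>t\<bar> < d" for t
        using deriv1[OF inball[OF t v] v]
          DERIV_shift[of "\<lambda>t. k (w + of_real t * v)" _ 0 t]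
        by (simp add: algebra_simps)
      show "((\<lambda>t. k1 v (w + of_real t * v)) has_real_derivative k2 v w) (at 0)"
        by (rule deriv2[OF wb v])
      show "k (w + of_real t * v) \<le> k (w + of_real 0 * v)" if "\<bar>t\<bar> < d" for t
      proof -
        have "w + of_real t * v \<in> cball 0 1"
          using inball[OF that v] ball_subset_cball by blast
        then show ?thesis using w(2) by simp
      qed
    qed
    then have "k2 1 w \<le> 0" "k2 \<i> w \<le> 0" by auto
    with pos[OF wb] show False by simp
  qed
  then have "w \<in> sphere 0 1" using w(1) by auto
  then show ?thesis using bound w(2)[OF z] by fastforce
qed

lemma vector_derivative_partial:
  assumes "partials_exist_on S f" "z \<in> S" "v \<in> {1, \<i>}"
  shows "((\<lambda>t::real. f (z + of_real t * v)) has_vector_derivative partial v f z) (at 0)"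
  using assms unfolding partials_exist_on_def partial_def
  by (auto simp: vector_derivative_works)

text \<open>The term \<open>A * (norm z)\<^sup>2\<close> has Laplacian \<open>4 * A\<close>, which
  outweighs that of \<open>Re (c * f z)\<close>, while \<open>Re (poly q z)\<close> is harmonic; the
  sum is therefore strictly subharmonic. On the circle the added term is the constant
  \<open>A\<close>.\<close>

lemma poisson_equation_le_boundary:
  assumes cont: "continuous_on (cball 0 1) f" and C2: "C_k_on 2 (ball 0 1) f"
    and lap: "\<And>z. z \<in> ball 0 1 \<Longrightarrow> norm (laplacian f z) \<le> M"
    and c: "norm c = 1" and A: "4 * A > M"
    and bound: "\<And>z. z \<in> sphere 0 1 \<Longrightarrow> Re (c * f z) + Re (poly q z) \<le> B"
    and z: "z \<in> cball 0 1"
  shows "Re (c * f z) + Re (poly q z) + A * (norm z)\<^sup>2 \<le> B + A"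
proof -
  have ex1: "partials_exist_on (ball 0 1) f"
    and ex2: "\<And>v. v \<in> {1, \<i>} \<Longrightarrow> partials_exist_on (ball 0 1) (partial v f)"
    using C2 by (auto simp: numeral_2_eq_2)
  have quad: "((\<lambda>t. A * (norm (z + of_real t * v))\<^sup>2) has_real_derivative 2 * A * Re (z * cnj v)) (at 0)"
    for z v :: complex
    unfolding cmod_power2 by (auto intro!: derivative_eq_intros simp: algebra_simps)
  \<comment> \<open>The factor \<open>w\<close> lets one fact serve both orders:
    \<open>w = 1\<close> for the first derivative and \<open>w = v\<close> for the second.\<close>
  have pol: "((\<lambda>t::real. Re (w * poly p (z + of_real t * v))) has_real_derivative
      Re (w * v * poly (pderiv p) z)) (at 0)" for w z v p
  proof -
    have "((\<lambda>t::real. w * poly p (z + of_real t * v)) has_vector_derivative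
        w * (v * poly (pderiv p) z)) (at 0)"
    proof (intro has_vector_derivative_mult_right)
      have "((\<lambda>t::real. z + of_real t * v) has_vector_derivative v) (at 0)"
        by (auto intro!: derivative_eq_intros simp: has_vector_derivative_def scaleR_conv_of_real)
      from field_vector_diff_chain_at[OF this, of "poly p" "poly (pderiv p) z"]
      show "((\<lambda>t::real. poly p (z + of_real t * v)) has_vector_derivative v * poly (pderiv p) z) (at 0)"
        by (simp add: o_def poly_DERIV)
    qed
    from has_field_derivative_Re[OF this] show ?thesis
      by (simp only: mult.assoc)
  qed
  have vecRe: "((\<lambda>t. Re (c * h t)) has_real_derivative Re (c * D)) (at 0)"
    if "(h has_vector_derivative D) (at 0)" for h :: "real \<Rightarrow> complex" and D
    by (intro has_field_derivative_Re has_vector_derivative_mult_right that)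
  show ?thesis
  proof (rule strict_subharmonic_le_boundary[where
        k = "\<lambda>z. Re (c * f z) + Re (poly q z) + A * (norm z)\<^sup>2" and
        ?k1.0 = "\<lambda>v z. Re (c * partial v f z) + Re (v * poly (pderiv q) z) + 2 * A * Re (z * cnj v)" and
        ?k2.0 = "\<lambda>v z. Re (c * partial v (partial v f) z) +
           Re (v * v * poly (pderiv (pderiv q)) z) + 2 * A", OF _ _ _ _ _ z])
    show "continuous_on (cball 0 1) (\<lambda>z. Re (c * f z) + Re (poly q z) + A * (norm z)\<^sup>2)"
      by (intro continuous_intros cont)
  next
    fix z v :: complex assume z: "z \<in> ball 0 1" and v: "v \<in> {1, \<i>}"
    show "((\<lambda>t. Re (c * f (z + of_real t * v)) + Re (poly q (z + of_real t * v)) +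
        A * (norm (z + of_real t * v))\<^sup>2) has_real_derivative
        Re (c * partial v f z) + Re (v * poly (pderiv q) z) + 2 * A * Re (z * cnj v)) (at 0)"
      by (intro DERIV_add vecRe vector_derivative_partial[OF ex1 z v] quad
          pol[of 1, simplified mult_1_left])
    have "((\<lambda>t. 2 * A * Re ((z + of_real t * v) * cnj v)) has_real_derivative 2 * A) (at 0)"
      using v by (auto intro!: derivative_eq_intros)
    then show "((\<lambda>t. Re (c * partial v f (z + of_real t * v)) + Re (v * poly (pderiv q) (z + of_real t * v)) +
        2 * A * Re ((z + of_real t * v) * cnj v)) has_real_derivative
        Re (c * partial v (partial v f) z) +
           Re (v * v * poly (pderiv (pderiv q)) z) + 2 * A) (at 0)"
      by (intro DERIV_add vecRe vector_derivative_partial[OF ex2[OF v] z v] pol)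
  next
    fix z :: complex assume z: "z \<in> ball 0 1"
    have "\<bar>Re (c * laplacian f z)\<bar> \<le> M"
      using abs_Re_le_cmod[of "c * laplacian f z"] lap[OF z] c by (simp add: norm_mult)
    then have "Re (c * laplacian f z) + 4 * A > 0"
      using A by linarith
    \<comment> \<open>The polynomial terms cancel because
      \<open>1 * 1 + \<i> * \<i> = 0\<close>.\<close>
    then show "0 < Re (c * partial 1 (partial 1 f) z) + Re (1 * 1 * poly (pderiv (pderiv q)) z) + 2 * A +
      (Re (c * partial \<i> (partial \<i> f) z) + Re (\<i> * \<i> * poly (pderiv (pderiv q)) z) + 2 * A)"
      by (simp add: laplacian_def algebra_simps)
  next
    fix z :: complex assume "z \<in> sphere 0 1"
    then show "Re (c * f z) + Re (poly q z) + A * (norm z)\<^sup>2 \<le> B + A"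
      using bound[of z] by simp
  qed
qed

section \<open>Uniform approximation on the circle by real parts of polynomials\<close>

text \<open>These are the real trigonometric polynomials. Agreement is asked on the circle only,
  since closure under products rests on \<open>cnj z = 1 / z\<close> there.\<close>

definition re_poly_on_circle :: "(complex \<Rightarrow> real) set" where
  "re_poly_on_circle = {u. \<exists>p. \<forall>z\<in>sphere 0 1. u z = Re (poly p z)}"

lemma re_poly_on_circle_monom: "(\<lambda>z. Re (a * z ^ n)) \<in> re_poly_on_circle"
  unfolding re_poly_on_circle_def by (auto intro!: exI[of _ "monom a n"] simp: poly_monom)

lemma re_poly_on_circle_add:
  assumes "u \<in> re_poly_on_circle" "v \<in> re_poly_on_circle"
  shows "(\<lambda>z. u z + v z) \<in> re_poly_on_circle"
proof -
  obtain p q where "\<forall>z\<in>sphere 0 1. u z = Re (poly p z)" "\<forall>z\<in>sphere 0 1. v z = Re (poly q z)"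
    using assms by (auto simp: re_poly_on_circle_def)
  then show ?thesis
    unfolding re_poly_on_circle_def by (auto intro!: exI[of _ "p + q"])
qed

lemma re_poly_on_circle_sum:
  assumes "finite I" "\<And>i. i \<in> I \<Longrightarrow> u i \<in> re_poly_on_circle"
  shows "(\<lambda>z. \<Sum>i\<in>I. u i z) \<in> re_poly_on_circle"
  using assms
proof (induction I)
  case empty
  show ?case using re_poly_on_circle_monom[of 0 0] by simp
qed (auto intro: re_poly_on_circle_add)

lemma re_poly_on_circle_cong:
  assumes "u \<in> re_poly_on_circle" "\<And>z. z \<in> sphere 0 1 \<Longrightarrow> u z = v z"
  shows "v \<in> re_poly_on_circle"
  using assms by (auto simp: re_poly_on_circle_def)

text \<open>From \<open>Re X * Re Y = Re (X * Y / 2) + Re (X * cnj Y / 2)\<close>: on the circle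
  \<open>cnj z ^ n\<close> is the inverse of \<open>z ^ n\<close>, so for \<open>n \<le> m\<close>
  the second product is again a monomial, of degree \<open>m - n\<close>. The other case follows by
  symmetry.\<close>

lemma re_poly_on_circle_monom_mult:
  "(\<lambda>z. Re (a * z ^ m) * Re (b * z ^ n)) \<in> re_poly_on_circle"
proof -
  have *: "(\<lambda>z. Re (a * z ^ m) * Re (b * z ^ n)) \<in> re_poly_on_circle" if le: "n \<le> m" for a b m n
  proof (rule re_poly_on_circle_cong)
    show "(\<lambda>z. Re (a * b / 2 * z ^ (m + n)) + Re (a * cnj b / 2 * z ^ (m - n))) \<in> re_poly_on_circle"
      by (intro re_poly_on_circle_add re_poly_on_circle_monom)
    fix z :: complex assume "z \<in> sphere 0 1"
    then have "z * cnj z = 1" by (simp add: complex_norm_square[symmetric])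
    then have "z ^ n * cnj z ^ n = 1" by (simp flip: power_mult_distrib)
    moreover have "z ^ m = z ^ (m - n) * z ^ n" using le by (simp flip: power_add)
    ultimately have "a * cnj b / 2 * z ^ (m - n) = a * z ^ m * cnj (b * z ^ n) / 2"
      by (simp add: algebra_simps)
    moreover have "a * b / 2 * z ^ (m + n) = a * z ^ m * (b * z ^ n) / 2"
      by (simp add: power_add)
    moreover have "Re X * Re Y = Re (X * Y / 2) + Re (X * cnj Y / 2)" for X Y
      by (simp add: field_simps)
    ultimately show "Re (a * b / 2 * z ^ (m + n)) + Re (a * cnj b / 2 * z ^ (m - n))
        = Re (a * z ^ m) * Re (b * z ^ n)"
      by (simp only:)
  qed
  show ?thesis
    using *[of n m a b] *[of m n b a] by (cases "n \<le> m") (simp_all add: mult.commute)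
qed

lemma re_poly_on_circle_mult:
  assumes "u \<in> re_poly_on_circle" "v \<in> re_poly_on_circle"
  shows "(\<lambda>z. u z * v z) \<in> re_poly_on_circle"
proof -
  obtain p q where "\<forall>z\<in>sphere 0 1. u z = Re (poly p z)" "\<forall>z\<in>sphere 0 1. v z = Re (poly q z)"
    using assms by (auto simp: re_poly_on_circle_def)
  then have *: "u z * v z = (\<Sum>i\<le>degree p. \<Sum>j\<le>degree q. Re (coeff p i * z ^ i) * Re (coeff q j * z ^ j))"
    if "z \<in> sphere 0 1" for z
    using that by (simp only: poly_altdef Re_sum sum_product)
  have "(\<lambda>z. \<Sum>i\<le>degree p. \<Sum>j\<le>degree q. Re (coeff p i * z ^ i) * Re (coeff q j * z ^ j))
      \<in> re_poly_on_circle"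
    by (intro re_poly_on_circle_sum re_poly_on_circle_monom_mult) auto
  then show ?thesis
    by (rule re_poly_on_circle_cong) (simp only: *)
qed

lemma real_continuous_on_circle_approx_re_poly:
  fixes u :: "complex \<Rightarrow> real"
  assumes "continuous_on (sphere 0 1) u" "e > 0"
  obtains p where "\<And>z. z \<in> sphere 0 1 \<Longrightarrow> \<bar>u z - Re (poly p z)\<bar> < e"
proof -
  have "\<exists>h. h \<in> re_poly_on_circle \<and> (\<forall>z\<in>sphere 0 1. \<bar>u z - h z\<bar> < e)"
  proof (rule Stone_Weierstrass_HOL[OF compact_sphere _ _ _ _ _ assms])
    show "(\<lambda>_. c) \<in> re_poly_on_circle" for c :: real
      using re_poly_on_circle_monom[of "of_real c" 0] by simp
    show "continuous_on (sphere 0 1) f" if f: "f \<in> re_poly_on_circle" for f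
    proof -
      obtain p where p: "\<forall>z\<in>sphere 0 1. f z = Re (poly p z)"
        using f by (auto simp: re_poly_on_circle_def)
      have "continuous_on (sphere 0 1) (\<lambda>z. Re (poly p z))"
        by (intro continuous_intros)
      then show ?thesis by (rule continuous_on_eq) (simp add: p)
    qed
    \<comment> \<open>Points with equal real parts are separated by
      \<open>Re (\<i> * z) = - Im z\<close>, all others by \<open>Re z\<close>.\<close>
    show "\<exists>f. f \<in> re_poly_on_circle \<and> f x \<noteq> f y"
      if "x \<in> sphere 0 1 \<and> y \<in> sphere 0 1 \<and> x \<noteq> y" for x y
    proof (cases "Re x = Re y")
      case True
      then have "Im x \<noteq> Im y" using that by (simp add: complex_eq_iff)
      then show ?thesis
        using re_poly_on_circle_monom[of \<i> 1] by (intro exI[of _ "\<lambda>z. Re (\<i> * z ^ 1)"]) auto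
    next
      case False
      then show ?thesis
        using re_poly_on_circle_monom[of 1 1] by (intro exI[of _ "\<lambda>z. Re (1 * z ^ 1)"]) auto
    qed
  qed (auto intro: re_poly_on_circle_add re_poly_on_circle_mult)
  then obtain h where h: "h \<in> re_poly_on_circle" "\<And>z. z \<in> sphere 0 1 \<Longrightarrow> \<bar>u z - h z\<bar> < e"
    by blast
  then obtain p where "\<forall>z\<in>sphere 0 1. h z = Re (poly p z)"
    by (auto simp: re_poly_on_circle_def)
  with h that show thesis by fastforce
qed

section \<open>The Poisson formula and a Schwarz lemma for harmonic functions\<close>

lemma poisson_kernel_denominator_pos:
  fixes r t :: real
  assumes "0 \<le> r" "r < 1"
  shows "1 - 2 * r * cos t + r\<^sup>2 > 0"
proof -
  have "r * cos t \<le> r * 1" using assms by (intro mult_left_mono) auto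
  moreover have "(1 - r)\<^sup>2 > 0" using assms by simp
  ultimately show ?thesis by (simp add: power2_eq_square algebra_simps)
qed

text \<open>Cauchy's formula at \<open>r\<close> for \<open>F\<close> times a factor that is
  holomorphic on the closed disc and equals \<open>1\<close> at \<open>r\<close>. On the circle this
  factor turns the Cauchy kernel into the Poisson kernel. Other points of the disc are reached later
  by a rotation.\<close>

lemma poisson_formula_on_positive_axis:
  fixes r :: real
  assumes hol: "F holomorphic_on cball 0 1" and r: "0 \<le> r" "r < 1"
  shows "((\<lambda>t. (1 - r\<^sup>2) / (1 - 2 * r * cos t + r\<^sup>2) * Re (F (cis t)))
    has_integral 2 * pi * Re (F (of_real r))) {0..2 * pi}"
proof -
  define G where "G w = F w * ((1 - of_real r ^ 2) / (1 - of_real r * w))" for w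
  have nz: "1 - of_real r * w \<noteq> 0" if "norm w \<le> 1" for w :: complex
  proof
    assume "1 - of_real r * w = 0"
    then have "norm (of_real r * w) = 1" by simp
    moreover have "r * norm w \<le> r * 1" using r that by (intro mult_left_mono) auto
    ultimately show False using r by (simp add: norm_mult)
  qed
  have "G holomorphic_on cball 0 1"
    unfolding G_def by (intro holomorphic_intros hol) (use nz in auto)
  then have "((\<lambda>u. G u / (u - of_real r)) has_contour_integral
      2 * of_real pi * \<i> * G (of_real r)) (circlepath 0 1)"
    by (rule Cauchy_integral_circlepath_simple) (use r in auto)
  then have "((\<lambda>t. G (cis t) / (cis t - of_real r) * \<i> * cis t) has_integral
      2 * of_real pi * \<i> * G (of_real r)) {0..2 * pi}"
    unfolding circlepath_def by (subst (asm) has_contour_integral_part_circlepath_iff) auto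
  from has_integral_linear[OF has_integral_mult_right[OF this, of "- \<i>"] bounded_linear_Re]
  have I: "((\<lambda>t. Re (- \<i> * (G (cis t) / (cis t - of_real r) * \<i> * cis t))) has_integral
      Re (- \<i> * (2 * of_real pi * \<i> * G (of_real r)))) {0..2 * pi}"
    by (simp add: o_def)
  have "1 - complex_of_real r ^ 2 \<noteq> 0"
    using nz[of "of_real r"] r by (simp add: power2_eq_square)
  then have "G (of_real r) = F (of_real r)"
    by (simp add: G_def power2_eq_square)
  then have R: "Re (- \<i> * (2 * of_real pi * \<i> * G (of_real r))) = 2 * pi * Re (F (of_real r))"
    by simp
  have P: "- \<i> * (G (cis t) / (cis t - of_real r) * \<i> * cis t) =
      of_real ((1 - r\<^sup>2) / (1 - 2 * r * cos t + r\<^sup>2)) * F (cis t)" for t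
  proof -
    have c: "cis t * cis (- t) = 1" by (simp add: cis_mult)
    have d: "cis t + cis (- t) = 2 * of_real (cos t)" by (simp add: complex_eq_iff)
    \<comment> \<open>The denominator of the kernel is the squared modulus of
      \<open>1 - of_real r * cis t\<close>.\<close>
    have "(1 - of_real r * cis t) * (1 - of_real r * cis (- t)) =
        1 - of_real r * (cis t + cis (- t)) + of_real r ^ 2 * (cis t * cis (- t))"
      by (simp add: algebra_simps power2_eq_square del: cis_mult)
    also have "\<dots> = of_real (1 - 2 * r * cos t + r\<^sup>2)"
      unfolding c d by simp
    finally have "(1 - of_real r * cis t) * (1 - of_real r * cis (- t)) =
        of_real (1 - 2 * r * cos t + r\<^sup>2)" .
    moreover have "cis t - of_real r = cis t * (1 - of_real r * cis (- t))"
      using c by (simp add: algebra_simps)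
    ultimately have "(1 - of_real r * cis t) * (cis t - of_real r) =
        cis t * of_real (1 - 2 * r * cos t + r\<^sup>2)"
      by (simp add: mult_ac)
    moreover have "- \<i> * (G (cis t) / (cis t - of_real r) * \<i> * cis t) =
        F (cis t) * of_real (1 - r\<^sup>2) * cis t / ((1 - of_real r * cis t) * (cis t - of_real r))"
    proof -
      have "- \<i> * (x * \<i> * y) = x * y" for x y
        by (simp add: algebra_simps)
      then show ?thesis by (simp add: G_def)
    qed
    ultimately show ?thesis by simp
  qed
  show ?thesis
    using I unfolding R P by simp
qed

text \<open>The kernel is \<open>1 + 2 * Re (w / (1 - w))\<close> with \<open>w = r * cis t\<close>,
  and an antiderivative of \<open>Re (w / (1 - w))\<close> in \<open>t\<close> is the argument of
  \<open>1 / (1 - w)\<close>, which is the arctangent in \<open>\<Phi>\<close>. As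
  \<open>1 - r * cos t\<close> is positive, this branch is smooth for all real
  \<open>t\<close>.\<close>

lemma poisson_kernel_has_integral:
  fixes r a b :: real
  defines "\<Phi> \<equiv> \<lambda>t. t + 2 * arctan (r * sin t / (1 - r * cos t))"
  assumes r: "0 \<le> r" "r < 1" and "a \<le> b"
  shows "((\<lambda>t. (1 - r\<^sup>2) / (1 - 2 * r * cos t + r\<^sup>2)) has_integral \<Phi> b - \<Phi> a) {a..b}"
proof (rule fundamental_theorem_of_calculus[OF \<open>a \<le> b\<close>])
  fix t assume "t \<in> {a..b}"
  have "r * cos t \<le> r * 1" using r by (intro mult_left_mono) auto
  then have nz: "1 - r * cos t > 0" using r by simp
  define q where "q = 1 - r * cos t"
  have q: "q > 0" using nz by (simp add: q_def)
  define D where "D = (r * cos t * q - r * sin t * (r * sin t)) / q\<^sup>2"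
  have D: "((\<lambda>t. r * sin t / (1 - r * cos t)) has_real_derivative D) (at t)"
    unfolding D_def q_def using nz by (auto intro!: derivative_eq_intros simp: power2_eq_square)
  have sc: "(r * sin t)\<^sup>2 = r\<^sup>2 - (r * cos t)\<^sup>2"
    by (simp add: power_mult_distrib sin_squared_eq algebra_simps)
  have den: "q\<^sup>2 + (r * sin t)\<^sup>2 = 1 - 2 * r * cos t + r\<^sup>2"
    unfolding sc by (simp add: q_def power2_eq_square algebra_simps)
  have "inverse (1 + (r * sin t / (1 - r * cos t))\<^sup>2) * D =
      (r * cos t * q - (r * sin t)\<^sup>2) / (q\<^sup>2 + (r * sin t)\<^sup>2)"
    unfolding q_def[symmetric] D_def power_divide using q
    by (simp add: divide_simps add_pos_nonneg power2_eq_square add_nonneg_eq_0_iff)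
  also have "\<dots> = (r * cos t - r\<^sup>2) / (1 - 2 * r * cos t + r\<^sup>2)"
    unfolding den unfolding sc by (simp add: q_def power2_eq_square algebra_simps)
  finally have quot: "inverse (1 + (r * sin t / (1 - r * cos t))\<^sup>2) * D =
      (r * cos t - r\<^sup>2) / (1 - 2 * r * cos t + r\<^sup>2)" .
  have E: "1 + 2 * (inverse (1 + (r * sin t / (1 - r * cos t))\<^sup>2) * D) =
      (1 - r\<^sup>2) / (1 - 2 * r * cos t + r\<^sup>2)"
    unfolding quot using poisson_kernel_denominator_pos[OF r, of t] by (simp add: field_simps)
  have "(\<Phi> has_real_derivative (1 - r\<^sup>2) / (1 - 2 * r * cos t + r\<^sup>2)) (at t)"
    unfolding \<Phi>_def E[symmetric]
    by (intro DERIV_add DERIV_ident DERIV_cmult DERIV_chain2[OF DERIV_arctan D])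
  then show "(\<Phi> has_vector_derivative (1 - r\<^sup>2) / (1 - 2 * r * cos t + r\<^sup>2)) (at t within {a..b})"
    by (simp add: has_real_derivative_iff_has_vector_derivative has_vector_derivative_at_within)
qed

text \<open>The kernel exceeds its value at angle \<open>\<pi>/2\<close>, subtracted here, exactly on the
  right half of the circle.\<close>

lemma abs_poisson_kernel_has_integral:
  fixes r :: real
  defines "c \<equiv> (1 - r\<^sup>2) / (1 + r\<^sup>2)"
  assumes r: "0 \<le> r" "r < 1"
  shows "((\<lambda>t. \<bar>(1 - r\<^sup>2) / (1 - 2 * r * cos t + r\<^sup>2) - c\<bar>) has_integral 8 * arctan r) {0..2 * pi}"
proof -
  define P where "P t = (1 - r\<^sup>2) / (1 - 2 * r * cos t + r\<^sup>2)" for t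
  have r2: "1 - r\<^sup>2 > 0" using r by (simp add: power_less_one_iff abs_square_less_1)
  have ge: "P t \<ge> c" if "cos t \<ge> 0" for t
    unfolding P_def c_def using poisson_kernel_denominator_pos[OF r, of t] r2 r that
    by (intro divide_left_mono) (auto intro!: mult_pos_pos add_pos_nonneg)
  have le: "P t \<le> c" if "cos t \<le> 0" for t
    unfolding P_def c_def using poisson_kernel_denominator_pos[OF r, of t] r2 r that
    by (intro divide_left_mono) (auto intro!: mult_pos_pos add_pos_nonneg mult_nonneg_nonpos)
  have int: "((\<lambda>t. P t - c) has_integral
      (b + 2 * arctan (r * sin b / (1 - r * cos b))) - (a + 2 * arctan (r * sin a / (1 - r * cos a)))
        - (b - a) * c) {a..b}" if "a \<le> b" for a b
    unfolding P_def
    by (intro has_integral_diff poisson_kernel_has_integral[OF r that])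
      (use has_integral_const_real[of c a b] that in simp)
  have s: "sin (3 * pi / 2) = -1" "cos (3 * pi / 2) = 0"
    using sin_periodic_pi[of "pi / 2"] cos_periodic_pi[of "pi / 2"] by (simp_all add: field_simps)
  have "((\<lambda>t. \<bar>P t - c\<bar>) has_integral pi / 2 + 2 * arctan r - pi / 2 * c) {0..pi / 2}"
  proof (rule has_integral_eq)
    show "((\<lambda>t. P t - c) has_integral pi / 2 + 2 * arctan r - pi / 2 * c) {0..pi / 2}"
      using int[of 0 "pi / 2"] by simp
    show "P t - c = \<bar>P t - c\<bar>" if "t \<in> {0..pi / 2}" for t
      using ge[of t] cos_ge_zero[of t] that by auto
  qed
  moreover have "((\<lambda>t. \<bar>P t - c\<bar>) has_integral - (pi - 4 * arctan r - pi * c)) {pi / 2..3 * pi / 2}"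
  proof (rule has_integral_eq)
    show "((\<lambda>t. - (P t - c)) has_integral - (pi - 4 * arctan r - pi * c)) {pi / 2..3 * pi / 2}"
      using int[of "pi / 2" "3 * pi / 2"] s by (intro has_integral_neg) (simp add: algebra_simps arctan_minus)
    show "- (P t - c) = \<bar>P t - c\<bar>" if "t \<in> {pi / 2..3 * pi / 2}" for t
      using le[of t] cos_ge_zero[of "t - pi"] cos_periodic_pi[of "t - pi"] that by auto
  qed
  ultimately have "((\<lambda>t. \<bar>P t - c\<bar>) has_integral
      (pi / 2 + 2 * arctan r - pi / 2 * c) + - (pi - 4 * arctan r - pi * c)) {0..3 * pi / 2}"
    by (intro has_integral_combine[of 0 "pi / 2" "3 * pi / 2"]) auto
  moreover have "((\<lambda>t. \<bar>P t - c\<bar>) has_integral pi / 2 + 2 * arctan r - pi / 2 * c) {3 * pi / 2..2 * pi}"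
  proof (rule has_integral_eq)
    show "((\<lambda>t. P t - c) has_integral pi / 2 + 2 * arctan r - pi / 2 * c) {3 * pi / 2..2 * pi}"
      using int[of "3 * pi / 2" "2 * pi"] s by (simp add: algebra_simps arctan_minus)
    show "P t - c = \<bar>P t - c\<bar>" if "t \<in> {3 * pi / 2..2 * pi}" for t
      using ge[of t] cos_ge_zero[of "t - 2 * pi"] cos_periodic[of "t - 2 * pi"] that by auto
  qed
  \<comment> \<open>The pieces meet at \<pi>/2 and 3\<pi>/2, where \<open>P t - c\<close> changes
    sign. In the sum all multiples of \<pi> and \<open>c\<close> cancel.\<close>
  ultimately have "((\<lambda>t. \<bar>P t - c\<bar>) has_integral
      ((pi / 2 + 2 * arctan r - pi / 2 * c) + - (pi - 4 * arctan r - pi * c)) +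
      (pi / 2 + 2 * arctan r - pi / 2 * c)) {0..2 * pi}"
    by (intro has_integral_combine[of 0 "3 * pi / 2" "2 * pi"]) auto
  then show ?thesis
    unfolding P_def by (simp add: field_simps)
qed

text \<open>Subtracting the constant in the previous lemma from the kernel is what brings
  \<open>F 0\<close>, the mean over the circle, into the estimate.\<close>

lemma harmonic_schwarz:
  assumes hol: "F holomorphic_on cball 0 1" and r: "0 \<le> r" "r < 1"
    and bound: "\<And>z. z \<in> sphere 0 1 \<Longrightarrow> \<bar>Re (F z)\<bar> \<le> B"
  shows "Re (F (of_real r)) \<le> (1 - r\<^sup>2) / (1 + r\<^sup>2) * Re (F 0) + B * (4 / pi * arctan r)"
proof -
  define c where "c = (1 - r\<^sup>2) / (1 + r\<^sup>2)"
  \<comment> \<open>At radius \<open>0\<close> the Poisson formula is the mean value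
    property.\<close>
  have "((\<lambda>t. c * Re (F (cis t))) has_integral c * (2 * pi * Re (F 0))) {0..2 * pi}"
    using poisson_formula_on_positive_axis[OF hol, of 0] by (intro has_integral_mult_right) simp
  from has_integral_diff[OF poisson_formula_on_positive_axis[OF hol r] this]
  have 1: "((\<lambda>t. ((1 - r\<^sup>2) / (1 - 2 * r * cos t + r\<^sup>2) - c) * Re (F (cis t))) has_integral
      2 * pi * (Re (F (of_real r)) - c * Re (F 0))) {0..2 * pi}"
    by (simp add: algebra_simps)
  have 2: "((\<lambda>t. \<bar>(1 - r\<^sup>2) / (1 - 2 * r * cos t + r\<^sup>2) - c\<bar> * B) has_integral
      8 * arctan r * B) {0..2 * pi}"
    unfolding c_def by (intro has_integral_mult_left abs_poisson_kernel_has_integral r)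
  have "2 * pi * (Re (F (of_real r)) - c * Re (F 0)) \<le> 8 * arctan r * B"
  proof (rule has_integral_le[OF 1 2])
    fix t
    have "x * Re (F (cis t)) \<le> \<bar>x\<bar> * B" for x
      using mult_left_mono[OF bound[of "cis t"], of "\<bar>x\<bar>"]
      by (simp flip: abs_mult)
    then show "((1 - r\<^sup>2) / (1 - 2 * r * cos t + r\<^sup>2) - c) * Re (F (cis t))
        \<le> \<bar>(1 - r\<^sup>2) / (1 - 2 * r * cos t + r\<^sup>2) - c\<bar> * B" .
  qed
  then show ?thesis
    unfolding c_def[symmetric] by (simp add: field_simps)
qed

section \<open>A Schwarz lemma for the Poisson equation\<close>

text \<open>Of the two error terms, the one with denominator \<open>1 + r\<^sup>2\<close> comes from
  the value at \<open>0\<close> of the harmonic comparison function, the other from comparing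
  \<open>f\<close> with that function at the point itself.\<close>

lemma schwarz_poisson_equation:
  assumes contf: "continuous_on (cball 0 1) f" and C2: "C_k_on 2 (ball 0 1) f"
    and lap: "\<And>z. z \<in> ball 0 1 \<Longrightarrow> norm (laplacian f z) \<le> M"
    and bound: "\<And>z. z \<in> sphere 0 1 \<Longrightarrow> norm (f z) \<le> 1"
    and f0: "f 0 = 0" and \<zeta>: "norm \<zeta> = 1" and r: "0 \<le> r" "r < 1"
  shows "norm (f (of_real r * \<zeta>)) \<le>
    4 / pi * arctan r + M / 4 * ((1 - r\<^sup>2) / (1 + r\<^sup>2) + (1 - r\<^sup>2))"
proof -
  define a where "a = (1 - r\<^sup>2) / (1 + r\<^sup>2)"
  have a: "a \<ge> 0" using r by (simp add: a_def power_le_one)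
  define z where "z = of_real r * \<zeta>"
  have z: "norm z = r" using \<zeta> r by (simp add: z_def norm_mult)
  \<comment> \<open>A rotation of the target makes the value at \<open>z\<close> real and
    nonnegative, so a bound on a real part suffices.\<close>
  obtain c where c: "norm c = 1" "Re (c * f z) = norm (f z)"
  proof (cases "f z = 0")
    case True
    then show thesis by (intro that[of 1]) auto
  next
    case False
    have "cnj (sgn (f z)) * f z = of_real (norm (f z))"
      using False complex_norm_square[of "f z"]
      by (simp add: sgn_div_norm scaleR_conv_of_real power2_eq_square field_simps)
    then show thesis
      using False by (intro that[of "cnj (sgn (f z))"]) (auto simp: norm_sgn)
  qed
  \<comment> \<open>Here \<open>e\<close> is the error of the boundary approximation, and
    \<open>A\<close> lies above \<open>M / 4\<close> to keep subharmonicity strict.\<close>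
  have estimate: "norm (f z) \<le> a * (e + A) + (1 + e) * (4 / pi * arctan r) + e + A * (1 - r\<^sup>2)"
    if e: "e > 0" and A: "4 * A > M" for e A
  proof -
    have "continuous_on (sphere 0 1) (\<lambda>z. Re (c * f z))"
      by (intro continuous_intros continuous_on_subset[OF contf]) auto
    from real_continuous_on_circle_approx_re_poly[OF this e]
    obtain p where p: "\<And>z. z \<in> sphere 0 1 \<Longrightarrow> \<bar>Re (c * f z) - Re (poly p z)\<bar> < e"
      by auto
    have le_p: "Re (c * f z) + Re (poly (- p) z) + A * (norm z)\<^sup>2 \<le> e + A"
    proof (rule poisson_equation_le_boundary[OF contf C2 lap c(1) A])
      show "Re (c * f w) + Re (poly (- p) w) \<le> e" if "w \<in> sphere 0 1" for w
        using p[OF that] by simp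
    qed (use z r in auto)
    \<comment> \<open>The opposite comparison, with \<open>- c\<close> for \<open>c\<close>; since
      \<open>f 0 = 0\<close>, it bounds \<open>Re (poly p 0)\<close> by
      \<open>e + A\<close>.\<close>
    have ge_p: "Re (- c * f 0) + Re (poly p 0) + A * (norm (0 :: complex))\<^sup>2 \<le> e + A"
    proof (rule poisson_equation_le_boundary[OF contf C2 lap _ A])
      show "Re (- c * f w) + Re (poly p w) \<le> e" if "w \<in> sphere 0 1" for w
        using p[OF that] by simp
    qed (use c in auto)
    \<comment> \<open>Precomposing with the rotation by \<open>\<zeta>\<close> brings the point to
      the positive axis; the approximation error raises the boundary bound from \<open>1\<close> to
      \<open>1 + e\<close>.\<close>
    have "Re (poly p (\<zeta> * of_real r)) \<le>
        a * Re (poly p (\<zeta> * 0)) + (1 + e) * (4 / pi * arctan r)"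
      unfolding a_def
    proof (rule harmonic_schwarz[where F = "\<lambda>w. poly p (\<zeta> * w)", OF _ r])
      show "(\<lambda>w. poly p (\<zeta> * w)) holomorphic_on cball 0 1"
        by (intro holomorphic_intros)
      fix w :: complex assume "w \<in> sphere 0 1"
      then have w: "\<zeta> * w \<in> sphere 0 1" using \<zeta> by (simp add: norm_mult)
      have "\<bar>Re (c * f (\<zeta> * w))\<bar> \<le> 1"
        using abs_Re_le_cmod[of "c * f (\<zeta> * w)"] bound[OF w] c(1) by (simp add: norm_mult)
      with p[OF w] show "\<bar>Re (poly p (\<zeta> * w))\<bar> \<le> 1 + e" by linarith
    qed
    moreover have "a * Re (poly p 0) \<le> a * (e + A)"
      using ge_p f0 a by (intro mult_left_mono) auto
    ultimately show ?thesis
      using le_p c(2) z by (simp add: z_def mult.commute algebra_simps)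
  qed
  \<comment> \<open>Both parameters are removed in one limit, with
    \<open>A = M / 4 + e\<close>.\<close>
  have "((\<lambda>e. a * (e + (M / 4 + e)) + (1 + e) * (4 / pi * arctan r) + e + (M / 4 + e) * (1 - r\<^sup>2))
      \<longlongrightarrow> a * (0 + (M / 4 + 0)) + (1 + 0) * (4 / pi * arctan r) + 0 + (M / 4 + 0) * (1 - r\<^sup>2))
      (at_right 0)"
    by (intro tendsto_intros)
  moreover have "\<forall>\<^sub>F e in at_right 0. norm (f z) \<le>
      a * (e + (M / 4 + e)) + (1 + e) * (4 / pi * arctan r) + e + (M / 4 + e) * (1 - r\<^sup>2)"
    using eventually_at_right_less[of "0 :: real"] by eventually_elim (rule estimate; simp)
  ultimately have "norm (f z) \<le>
      a * (0 + (M / 4 + 0)) + (1 + 0) * (4 / pi * arctan r) + 0 + (M / 4 + 0) * (1 - r\<^sup>2)"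
    by (intro tendsto_lowerbound) auto
  then show ?thesis
    unfolding z_def[symmetric] a_def[symmetric] by (simp add: algebra_simps add_divide_distrib)
qed

section \<open>Radial limits and the lower bound\<close>

lemma norm_le_disc_norm:
  assumes "continuous_on (cball 0 1) g" "z \<in> ball 0 1"
  shows "norm (g z) \<le> disc_norm g"
proof -
  have "bounded (g ` cball 0 1)"
    by (intro compact_imp_bounded compact_continuous_image assms) auto
  then obtain K where "\<forall>x\<in>cball 0 1. norm (g x) \<le> K"
    by (auto simp: bounded_iff)
  then have "bdd_above ((\<lambda>z. norm (g z)) ` ball 0 1)"
    by (intro bdd_aboveI2[of _ _ K]) auto
  then show ?thesis
    unfolding disc_norm_def using assms(2) by (rule cSUP_upper2) auto
qed

lemma at_within_unit_interval_eq_at_left: "at (1::real) within {0..<1} = at_left 1"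
proof (rule at_within_nhd[of _ "{0<..}"])
  show "{0..<1} \<inter> {0<..} - {1} = {..<1} \<inter> {0<..} - {1::real}" by auto
qed auto

lemma eventually_at_left_in_unit_interval: "\<forall>\<^sub>F r in at_left (1::real). r \<in> {0<..<1}"
  by (rule eventually_at_left_real) simp

lemma tendsto_radial:
  fixes f :: "complex \<Rightarrow> complex"
  assumes "continuous_on (cball 0 1) f" "norm \<zeta> = 1"
  shows "((\<lambda>r. f (of_real r * \<zeta>)) \<longlongrightarrow> f \<zeta>) (at_left (1::real))"
proof -
  have "((\<lambda>r::real. of_real r * \<zeta>) \<longlongrightarrow> of_real 1 * \<zeta>) (at_left 1)"
    by (intro tendsto_mult tendsto_of_real tendsto_ident_at tendsto_const)
  moreover have "\<forall>\<^sub>F r::real in at_left 1. of_real r * \<zeta> \<in> cball 0 1"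
    using eventually_at_left_in_unit_interval assms(2)
    by (auto elim!: eventually_mono simp: norm_mult)
  ultimately show ?thesis
    using continuous_on_tendsto_compose[OF assms(1), of "\<lambda>r. of_real r * \<zeta>" \<zeta>] assms(2) by simp
qed

text \<open>This is the difference quotient at \<open>1\<close> of \<open>4 / pi * arctan r\<close>,
  which has value \<open>1\<close> and derivative \<open>2 / pi\<close> there.\<close>

lemma tendsto_arctan_quotient:
  "((\<lambda>r. (1 - 4 / pi * arctan r) / (1 - r)) \<longlongrightarrow> 2 / pi) (at_left (1::real))"
proof -
  have "((\<lambda>r. 4 / pi * arctan r) has_real_derivative 4 / pi * inverse (1 + 1\<^sup>2)) (at 1)"
    by (intro DERIV_cmult DERIV_arctan)
  then have "((\<lambda>r. (4 / pi * arctan r - 4 / pi * arctan 1) / (r - 1)) \<longlongrightarrow> 2 / pi) (at 1)"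
    by (simp add: has_field_derivative_iff)
  then have "((\<lambda>r. (4 / pi * arctan r - 4 / pi * arctan 1) / (r - 1)) \<longlongrightarrow> 2 / pi) (at_left 1)"
    by (rule filterlim_mono) (auto simp: at_within_le_at)
  moreover have "(4 / pi * arctan r - 4 / pi * arctan 1) / (r - 1) =
      (1 - 4 / pi * arctan r) / (1 - r)" for r :: real
    using minus_divide_divide[of "1 - 4 / pi * arctan r" "1 - r"] by simp
  ultimately show ?thesis by simp
qed

lemma radial_liminf_ge:
  assumes "poisson_self_map g f \<zeta>"
  shows "radial_liminf f \<zeta> \<ge> ereal (2 / pi - 3 * disc_norm g / 4)"
proof -
  define M where "M = disc_norm g"
  from assms have contg: "continuous_on (cball 0 1) g" and contf: "continuous_on (cball 0 1) f"
    and C2: "C_k_on 2 (ball 0 1) f" and ran: "f ` ball 0 1 \<subseteq> ball 0 1"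
    and lap: "\<And>z. z \<in> ball 0 1 \<Longrightarrow> laplacian f z = g z" and f0: "f 0 = 0" and \<zeta>: "norm \<zeta> = 1"
    and lim: "((\<lambda>r::real. norm (f (of_real r * \<zeta>))) \<longlongrightarrow> 1) (at_left 1)"
    by (auto simp: poisson_self_map_def at_within_unit_interval_eq_at_left)
  have lapM: "norm (laplacian f z) \<le> M" if "z \<in> ball 0 1" for z
    using norm_le_disc_norm[OF contg that] lap[OF that] by (simp add: M_def)
  have "norm (f \<zeta>) = 1"
    using tendsto_norm[OF tendsto_radial[OF contf \<zeta>]] lim
    by (rule tendsto_unique[rotated]) simp
  \<comment> \<open>The range hypothesis concerns the open disc; radial limits carry it to the
    circle.\<close>
  have bound: "norm (f z) \<le> 1" if "z \<in> sphere 0 1" for z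
  proof (rule tendsto_upperbound)
    show "((\<lambda>r::real. norm (f (of_real r * z))) \<longlongrightarrow> norm (f z)) (at_left 1)"
      using that by (intro tendsto_norm tendsto_radial contf) simp
    show "\<forall>\<^sub>F r::real in at_left 1. norm (f (of_real r * z)) \<le> 1"
      using eventually_at_left_in_unit_interval
    proof (eventually_elim)
      case (elim r)
      then have "of_real r * z \<in> ball 0 1" using that by (simp add: norm_mult)
      with ran show ?case by (auto simp: less_imp_le image_subset_iff)
    qed
  qed simp
  \<comment> \<open>This is \<open>1\<close> minus the Schwarz bound, divided by
    \<open>1 - r\<close>; cancelling \<open>1 - r\<close> from \<open>1 - r\<^sup>2\<close> leaves a
    limit at \<open>1\<close>, where the bracket tends to \<open>3\<close>.\<close>
  define b where "b r = (1 - 4 / pi * arctan r) / (1 - r) - M / 4 * ((1 + r) / (1 + r\<^sup>2) + (1 + r))"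
    for r :: real
  have b: "b r \<le> norm (f \<zeta> - f (of_real r * \<zeta>)) / (1 - r)" if r: "0 < r" "r < 1" for r
  proof -
    have eq: "1 - r\<^sup>2 = (1 - r) * (1 + r)" by (simp add: power2_eq_square algebra_simps)
    have "(1 - r) * b r =
        1 - (4 / pi * arctan r + M / 4 * ((1 - r\<^sup>2) / (1 + r\<^sup>2) + (1 - r\<^sup>2)))"
    proof -
      have "(1 - r) * (X / (1 - r) - M / 4 * ((1 + r) / Q + (1 + r))) =
          X - M / 4 * ((1 - r) * (1 + r) / Q + (1 - r) * (1 + r))" for X Q
        using r by (simp add: right_diff_distrib) (simp add: divide_inverse algebra_simps)
      then show ?thesis unfolding b_def eq by simp
    qed
    also have "\<dots> \<le> norm (f \<zeta>) - norm (f (of_real r * \<zeta>))"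
      using schwarz_poisson_equation[OF contf C2 lapM bound f0 \<zeta>, of r] r \<open>norm (f \<zeta>) = 1\<close>
      by simp
    also have "\<dots> \<le> norm (f \<zeta> - f (of_real r * \<zeta>))"
      by (rule norm_triangle_ineq2)
    finally show ?thesis
      using r by (simp add: pos_le_divide_eq mult.commute)
  qed
  have "(b \<longlongrightarrow> 2 / pi - M / 4 * ((1 + 1) / (1 + 1\<^sup>2) + (1 + 1))) (at_left 1)"
    unfolding b_def by (intro tendsto_intros tendsto_arctan_quotient) auto
  then have "((\<lambda>r. ereal (b r)) \<longlongrightarrow> ereal (2 / pi - 3 * M / 4)) (at_left 1)"
    by (simp add: algebra_simps)
  then have "ereal (2 / pi - 3 * M / 4) = Liminf (at_left 1) (\<lambda>r. ereal (b r))"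
    by (intro lim_imp_Liminf[symmetric]) auto
  also have "\<dots> \<le> radial_liminf f \<zeta>"
    unfolding radial_liminf_def at_within_unit_interval_eq_at_left
    using eventually_at_left_in_unit_interval
    by (intro Liminf_mono) (auto elim!: eventually_mono intro!: b)
  finally show ?thesis by (simp add: M_def)
qed

section \<open>Sharpness: real parts of holomorphic functions and the arctangent\<close>

text \<open>Agreement of \<open>f\<close> with \<open>Re (F z)\<close> is assumed on
  \<open>S\<close> only, which is all that is known of a partial derivative when the result is
  iterated; openness of \<open>S\<close> makes the agreement hold near \<open>z\<close>.\<close>

lemma has_vector_derivative_Re_holomorphic:
  assumes "open S" "F holomorphic_on S" "\<And>z. z \<in> S \<Longrightarrow> f z = complex_of_real (Re (F z))" "z \<in> S"
  shows "((\<lambda>t::real. f (z + of_real t * v)) has_vector_derivative of_real (Re (v * deriv F z))) (at 0)"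
proof -
  have "((\<lambda>t::real. z + of_real t * v) has_vector_derivative v) (at 0)"
    by (auto intro!: derivative_eq_intros simp: has_vector_derivative_def scaleR_conv_of_real)
  then have "((\<lambda>t::real. F (z + of_real t * v)) has_vector_derivative v * deriv F z) (at 0)"
    using field_vector_diff_chain_at[of "\<lambda>t. z + of_real t * v" v 0 F "deriv F z"]
      holomorphic_derivI[OF assms(2,1,4)] by (simp add: o_def)
  then have "((\<lambda>t::real. complex_of_real (Re (F (z + of_real t * v)))) has_vector_derivative
      of_real (Re (v * deriv F z))) (at 0)"
    by (intro has_vector_derivative_of_real has_field_derivative_Re)
  moreover have "\<forall>\<^sub>F t::real in nhds 0. z + of_real t * v \<in> S"
  proof -
    have "((\<lambda>t::real. z + of_real t * v) \<longlongrightarrow> z + of_real 0 * v) (nhds 0)"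
      by (intro tendsto_intros filterlim_ident)
    then show ?thesis
      using eventually_compose_filterlim[OF eventually_nhds_in_open[OF assms(1,4)]] by simp
  qed
  then have "\<forall>\<^sub>F t::real in nhds 0. f (z + of_real t * v) = complex_of_real (Re (F (z + of_real t * v)))"
    by eventually_elim (rule assms(3))
  ultimately show "((\<lambda>t::real. f (z + of_real t * v)) has_vector_derivative
      of_real (Re (v * deriv F z))) (at 0)"
    using assms(3,4)
    by (subst has_vector_derivative_cong_ev[where g = "\<lambda>t. complex_of_real (Re (F (z + of_real t * v)))"
          and S = UNIV]) (auto elim: eventually_mono)
qed

lemma partial_Re_holomorphic:
  assumes "open S" "F holomorphic_on S" "\<And>z. z \<in> S \<Longrightarrow> f z = of_real (Re (F z))" "z \<in> S"
  shows "partial v f z = of_real (Re (v * deriv F z))"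
  unfolding partial_def
  by (rule vector_derivative_at[OF has_vector_derivative_Re_holomorphic[OF assms]])

text \<open>Each partial derivative is again the real part of a holomorphic function,
  \<open>v * deriv F z\<close>, so the induction closes once \<open>F\<close> and \<open>f\<close>
  vary.\<close>

lemma C_k_on_Re_holomorphic:
  assumes "open S" "F holomorphic_on S" "\<And>z. z \<in> S \<Longrightarrow> f z = of_real (Re (F z))"
  shows "C_k_on k S f"
  using assms(2,3)
proof (induction k arbitrary: F f)
  case 0
  have "continuous_on S (\<lambda>z. complex_of_real (Re (F z)))"
    by (intro continuous_intros holomorphic_on_imp_continuous_on 0)
  then show ?case using 0(2) by (simp cong: continuous_on_cong)
next
  case (Suc k)
  have "continuous_on S (\<lambda>z. complex_of_real (Re (F z)))"
    by (intro continuous_intros holomorphic_on_imp_continuous_on Suc)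
  then have "continuous_on S f" using Suc(3) by (simp cong: continuous_on_cong)
  moreover have "partials_exist_on S f"
    unfolding partials_exist_on_def
    using has_vector_derivative_Re_holomorphic[OF \<open>open S\<close> Suc(2,3)] by (blast intro: differentiableI_vector)
  moreover have "C_k_on k S (partial v f)" for v
  proof (rule Suc.IH)
    show "(\<lambda>z. v * deriv F z) holomorphic_on S"
      by (intro holomorphic_intros holomorphic_deriv Suc(2) \<open>open S\<close>)
    show "partial v f z = of_real (Re (v * deriv F z))" if "z \<in> S" for z
      using partial_Re_holomorphic[OF \<open>open S\<close> Suc(2,3) that] .
  qed
  ultimately show ?case by simp
qed

text \<open>The second partial derivative along \<open>v\<close> is the real part of
  \<open>v * v\<close> times the second derivative of \<open>F\<close>, and the squares of
  \<open>1\<close> and \<open>\<i>\<close> sum to \<open>0\<close>.\<close>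

lemma laplacian_Re_holomorphic:
  assumes "open S" "F holomorphic_on S" "\<And>z. z \<in> S \<Longrightarrow> f z = of_real (Re (F z))" "z \<in> S"
  shows "laplacian f z = 0"
proof -
  have "partial v (partial v f) z = of_real (Re (v * (v * deriv (deriv F) z)))" for v
  proof -
    have "partial v (partial v f) z = of_real (Re (v * deriv (\<lambda>z. v * deriv F z) z))"
    proof (rule partial_Re_holomorphic[OF \<open>open S\<close> _ _ \<open>z \<in> S\<close>])
      show "(\<lambda>z. v * deriv F z) holomorphic_on S"
        by (intro holomorphic_intros holomorphic_deriv assms)
      show "partial v f w = of_real (Re (v * deriv F w))" if "w \<in> S" for w
        using partial_Re_holomorphic[OF assms(1-3) that] .
    qed
    also have "deriv (\<lambda>z. v * deriv F z) z = v * deriv (deriv F) z"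
      using holomorphic_deriv[OF assms(2,1)] assms(1,4)
      by (intro deriv_cmult) (auto simp: holomorphic_on_open field_differentiable_def)
    finally show ?thesis .
  qed
  then show ?thesis by (simp add: laplacian_def)
qed

text \<open>For \<open>w = tan (x + \<i> * y)\<close> the squared modulus is the quotient of
  \<open>(sin x)\<^sup>2 + q\<close> by \<open>(cos x)\<^sup>2 + q\<close> with
  \<open>q = (sinh y)\<^sup>2\<close>. When it is below \<open>1\<close>, dropping \<open>q\<close>
  from both can only decrease it, so \<open>tan \<bar>x\<bar> \<le> norm w\<close>.\<close>

lemma abs_Re_Arctan_le:
  assumes "norm w < 1"
  shows "\<bar>Re (Arctan w)\<bar> \<le> arctan (norm w)"
proof -
  define x where "x = \<bar>Re (Arctan w)\<bar>"
  define q where "q = (exp (Im (Arctan w)) - inverse (exp (Im (Arctan w))))\<^sup>2 / 4"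
  have q: "q \<ge> 0" by (simp add: q_def)
  have Im: "Re w = 0 \<Longrightarrow> \<bar>Im w\<bar> < 1"
    using assms abs_Im_le_cmod[of w] by simp
  have x: "0 \<le> x" "x < pi / 2"
    using Re_Arctan_bounds[OF Im] by (simp_all add: x_def)
  have cx: "cos x > 0" using x by (intro cos_gt_zero_pi) auto
  have cosx: "cos x = cos (Re (Arctan w))" "(sin x)\<^sup>2 = (sin (Re (Arctan w)))\<^sup>2"
    by (auto simp: x_def abs_if)
  have w2: "w\<^sup>2 \<noteq> -1"
  proof
    assume "w\<^sup>2 = -1"
    then have "norm w ^ 2 = 1" by (simp flip: norm_power)
    then show False using assms by (simp add: abs_square_eq_1)
  qed
  have c: "(norm (cos (Arctan w)))\<^sup>2 = (cos x)\<^sup>2 + q"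
    by (simp add: norm_cos_squared q_def cosx)
  have s: "(norm (sin (Arctan w)))\<^sup>2 = (sin x)\<^sup>2 + q"
    by (simp add: norm_sin_squared q_def cosx cos_double_sin power2_diff exp_double power_inverse)
  have den: "(cos x)\<^sup>2 + q \<noteq> 0"
    using cx q by (simp add: add_nonneg_eq_0_iff)
  have "(norm w)\<^sup>2 = (norm (sin (Arctan w)))\<^sup>2 / (norm (cos (Arctan w)))\<^sup>2"
    using tan_Arctan[OF w2] by (metis norm_divide power_divide tan_def)
  then have w: "(norm w)\<^sup>2 * ((cos x)\<^sup>2 + q) = (sin x)\<^sup>2 + q"
    unfolding c s by (subst (asm) nonzero_eq_divide_eq[OF den])
  have "(norm w)\<^sup>2 \<le> 1" using assms by (simp add: power_le_one)
  then have "(norm w)\<^sup>2 * q \<le> 1 * q" using q by (intro mult_right_mono)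
  with w have "(sin x)\<^sup>2 \<le> (norm w * cos x)\<^sup>2"
    by (simp add: distrib_left power_mult_distrib)
  then have "sin x \<le> norm w * cos x"
    by (rule power2_le_imp_le) (use cx in simp)
  then have "tan x \<le> norm w"
    unfolding tan_def using cx by (simp add: pos_divide_le_eq)
  then have "arctan (tan x) \<le> arctan (norm w)"
    by (simp add: arctan_le_iff)
  moreover have "arctan (tan x) = x"
    using x by (intro arctan_tan) auto
  ultimately show ?thesis
    by (simp only: x_def)
qed

text \<open>Scaling by \<open>s\<close> keeps the argument away from the singularities of
  \<open>Arctan\<close> at \<plusminus>\<i>, which gives continuity up to the circle; dividing by
  \<open>arctan s\<close> makes the value at \<open>1\<close> equal to \<open>1\<close>.\<close>

lemma Re_Arctan_self_map:
  assumes s: "0 < s" "s < 1"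
  obtains f where "poisson_self_map (\<lambda>_. 0) f 1"
    and "radial_liminf f 1 = ereal (s / ((1 + s\<^sup>2) * arctan s))"
proof -
  define f where "f z = complex_of_real (Re (Arctan (of_real s * z)) / arctan s)" for z
  have pos: "arctan s > 0" using s by simp
  have less1: "norm (of_real s * z) < 1" if "norm z \<le> 1" for z :: complex
  proof -
    have "s * norm z \<le> s * 1" using that s by (intro mult_left_mono) auto
    then have "s * norm z < 1" using s by linarith
    then show ?thesis using s by (simp add: norm_mult)
  qed
  define F where "F z = Arctan (of_real s * z) / of_real (arctan s)" for z
  have "(Arctan \<circ> (\<lambda>z. of_real s * z)) holomorphic_on cball 0 1"
  proof (rule holomorphic_on_compose)
    show "Arctan holomorphic_on (\<lambda>z. of_real s * z) ` cball 0 1"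
    proof (rule holomorphic_on_Arctan)
      fix w :: complex assume "w \<in> (\<lambda>z. of_real s * z) ` cball 0 1"
      then have "norm w < 1" using less1 by auto
      then show "\<bar>Im w\<bar> < 1" using abs_Im_le_cmod[of w] by simp
    qed
  qed (intro holomorphic_intros)
  then have hol: "F holomorphic_on cball 0 1"
    unfolding F_def using pos by (intro holomorphic_intros) (auto simp: o_def)
  then have hol': "F holomorphic_on ball 0 1"
    by (rule holomorphic_on_subset) auto
  have fF: "f z = of_real (Re (F z))" for z
    by (simp add: f_def F_def)
  have real: "f (of_real r) = of_real (arctan (s * r) / arctan s)" for r :: real
    using Arctan_of_real[of "s * r"] by (simp add: f_def)
  have contf: "continuous_on (cball 0 1) f"
    unfolding fF by (intro continuous_intros holomorphic_on_imp_continuous_on hol)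
  have "f z \<in> ball 0 1" if "z \<in> ball 0 1" for z
  proof -
    have "s * norm z < s" using that s by simp
    then have "\<bar>Re (Arctan (of_real s * z))\<bar> < arctan s"
      using abs_Re_Arctan_le[OF less1[of z]] arctan_less_iff[of "s * norm z" s] that s
      by (simp add: norm_mult)
    then have "\<bar>Re (Arctan (of_real s * z)) / arctan s\<bar> < 1" using pos by simp
    then show ?thesis by (simp only: f_def mem_ball_0 norm_of_real)
  qed
  moreover have "((\<lambda>r::real. norm (f (of_real r * 1))) \<longlongrightarrow> 1) (at_left 1)"
    using tendsto_norm[OF tendsto_radial[OF contf, of 1]] real[of 1] pos by simp
  ultimately have self_map: "poisson_self_map (\<lambda>_. 0) f 1"
    unfolding poisson_self_map_def at_within_unit_interval_eq_at_left
    using contf C_k_on_Re_holomorphic[OF open_ball hol' fF, of 2]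
      laplacian_Re_holomorphic[OF open_ball hol' fF] real[of 0]
    by (auto simp: disc_norm_def)
  have "((\<lambda>r. arctan (s * r) / arctan s) has_real_derivative s / ((1 + s\<^sup>2) * arctan s)) (at 1)"
    using pos by (auto intro!: derivative_eq_intros simp: divide_inverse mult_ac)
  then have "((\<lambda>r. (arctan (s * r) / arctan s - 1) / (r - 1)) \<longlongrightarrow> s / ((1 + s\<^sup>2) * arctan s)) (at 1)"
    using pos by (simp add: has_field_derivative_iff)
  then have lim: "((\<lambda>r. (arctan (s * r) / arctan s - 1) / (r - 1)) \<longlongrightarrow> s / ((1 + s\<^sup>2) * arctan s))
      (at_left 1)"
    by (rule filterlim_mono) (auto simp: at_within_le_at)
  \<comment> \<open>On the real axis \<open>f\<close> is real and stays below its value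
    \<open>1\<close> at \<open>1\<close>, so the modulus is the plain difference and the limit is a
    derivative.\<close>
  have quot: "norm (f 1 - f (of_real r * 1)) / (1 - r) = (arctan (s * r) / arctan s - 1) / (r - 1)"
    if "r < 1" for r
  proof -
    have "s * r < s" using that s by simp
    then have "arctan (s * r) / arctan s < 1" using pos by (simp add: arctan_less_iff)
    moreover have "f 1 - f (of_real r * 1) = of_real (1 - arctan (s * r) / arctan s)"
      using real[of 1] real[of r] pos by simp
    ultimately have "norm (f 1 - f (of_real r * 1)) = 1 - arctan (s * r) / arctan s"
      by (simp only: norm_of_real)
    then show ?thesis
      using minus_divide_divide[of "1 - arctan (s * r) / arctan s" "1 - r"]
      by (simp only: minus_diff_eq)
  qed
  have "\<forall>\<^sub>F r in at_left 1. (arctan (s * r) / arctan s - 1) / (r - 1) =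
      norm (f 1 - f (of_real r * 1)) / (1 - r)"
    using eventually_at_left_in_unit_interval by (rule eventually_mono) (rule quot[symmetric], simp)
  with lim have "((\<lambda>r. norm (f 1 - f (of_real r * 1)) / (1 - r)) \<longlongrightarrow> s / ((1 + s\<^sup>2) * arctan s))
      (at_left 1)"
    by (rule Lim_transform_eventually)
  then have "radial_liminf f 1 = ereal (s / ((1 + s\<^sup>2) * arctan s))"
    unfolding radial_liminf_def at_within_unit_interval_eq_at_left
    by (intro lim_imp_Liminf) auto
  with self_map show thesis by (rule that)
qed

theorem theorem2:
  shows "(\<forall>g f \<zeta>. poisson_self_map g f \<zeta> \<longrightarrow>
            radial_liminf f \<zeta> \<ge> ereal (2 / pi - 3 * disc_norm g / 4)) \<and>
         (\<forall>c::real. c > 2 / pi \<longrightarrow>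
            \<not> (\<forall>g f \<zeta>. poisson_self_map g f \<zeta> \<and> disc_norm g = 0 \<longrightarrow>
                  radial_liminf f \<zeta> \<ge> ereal c))"
proof (intro conjI allI impI notI)
  fix g f \<zeta> assume "poisson_self_map g f \<zeta>"
  then show "ereal (2 / pi - 3 * disc_norm g / 4) \<le> radial_liminf f \<zeta>"
    by (rule radial_liminf_ge)
next
  fix c :: real
  assume c: "c > 2 / pi" and
    all: "\<forall>g f \<zeta>. poisson_self_map g f \<zeta> \<and> disc_norm g = 0 \<longrightarrow> radial_liminf f \<zeta> \<ge> ereal c"
  \<comment> \<open>As \<open>s\<close> tends to \<open>1\<close> the radial derivative tends to
    \<open>2 / pi\<close>, so some \<open>s\<close> brings it below \<open>c\<close>.\<close>
  have "((\<lambda>s. s / ((1 + s\<^sup>2) * arctan s)) \<longlongrightarrow> 1 / ((1 + 1\<^sup>2) * arctan 1)) (at_left 1)"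
    by (intro tendsto_intros) (auto simp: add_nonneg_eq_0_iff)
  then have "\<forall>\<^sub>F s in at_left 1. s / ((1 + s\<^sup>2) * arctan s) < c"
    using c by (intro order_tendstoD(2)) auto
  then have "\<forall>\<^sub>F s in at_left 1. s / ((1 + s\<^sup>2) * arctan s) < c \<and> s \<in> {0<..<1::real}"
    using eventually_at_left_in_unit_interval by eventually_elim auto
  then obtain s :: real where s: "s / ((1 + s\<^sup>2) * arctan s) < c" "0 < s" "s < 1"
    using eventually_happens'[of "at_left (1::real)"] by fastforce
  obtain f where f: "poisson_self_map (\<lambda>_. 0) f 1"
    "radial_liminf f 1 = ereal (s / ((1 + s\<^sup>2) * arctan s))"
    by (rule Re_Arctan_self_map[OF s(2,3)])
  have "disc_norm (\<lambda>_. 0) = 0" by (simp add: disc_norm_def)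
  then have "ereal c \<le> radial_liminf f 1" using all f(1) by blast
  then show False using f(2) s(1) by simp
qed

end
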